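(* Let $\lambda$ be a regular cardinal, let $\mathscr U=\{u\subseteq\lambda:\mathrm{cf}(\sup(u))\ne\mathrm{cf}(|u|)\}$, and let $\mathscr D$ be a fine normal filter on $\mathscr U$. Then there are functions $f^*_i$ for $i<\lambda^+$ with $\mathrm{Dom}(f^*_i)=\mathscr U$ and $f^*_i(u)\in u$ for all $u\in\mathscr U$, such that for all $i\ne j<\lambda^+$ the set $\{u\in\mathscr U:f^*_i(u)\ne f^*_j(u)\}$ belongs to $\mathscr D$.
   Context: A filter $\mathscr D$ on $\mathscr U\subseteq\mathcal P(\lambda)$ is fine if $\{u\in\mathscr U:\alpha\in u\}\in\mathscr D$ for every $\alpha<\lambda$, and normal if for every sequence $\langle X_\alpha:\alpha<\lambda\rangle$ of members of $\mathscr D$ the diagonal intersection $\{u\in\mathscr U:u\in X_\alpha\text{ for all }\alpha\in u\}$ belongs to $\mathscr D$. *)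

theory Defs
  imports Main
begin

text \<open>The cardinal lambda is represented by a cardinal well-order r (a relation
on its field Field r, the set of ordinals below lambda). Subsets of lambda are
subsets of Field r.\<close>

text \<open>The ordinal sup(u) (von Neumann: union of u) as the initial segment of
the well-order consisting of elements strictly below some element of u.\<close>
definition ord_sup_set :: "'a rel \<Rightarrow> 'a set \<Rightarrow> 'a set" where
  "ord_sup_set r u = {x \<in> Field r. \<exists>y\<in>u. (x, y) \<in> r \<and> x \<noteq> y}"

definition cofinal_subset :: "'a rel \<Rightarrow> 'a set \<Rightarrow> 'a set \<Rightarrow> bool" where
  "cofinal_subset r S C \<longleftrightarrow> C \<subseteq> S \<and> (\<forall>x\<in>S. \<exists>c\<in>C. (x, c) \<in> r)"

text \<open>C witnesses the cofinality of (S, r): a cofinal subset of minimal cardinality,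
so that |C| is cf of the order type of (S, r).\<close>
definition cf_witness :: "'a rel \<Rightarrow> 'a set \<Rightarrow> 'a set \<Rightarrow> bool" where
  "cf_witness r S C \<longleftrightarrow> cofinal_subset r S C \<and>
     (\<forall>C'. cofinal_subset r S C' \<longrightarrow> (card_of C, card_of C') \<in> ordLeq)"

definition cf_sup_ne_cf_card :: "'a rel \<Rightarrow> 'a set \<Rightarrow> bool" where
  "cf_sup_ne_cf_card r u \<longleftrightarrow>
     (\<forall>C1 C2. cf_witness r (ord_sup_set r u) C1 \<and> cf_witness (card_of u) u C2 \<longrightarrow> (card_of C1, card_of C2) \<notin> ordIso)"

definition U_set :: "'a rel \<Rightarrow> 'a set set" where
  "U_set r = {u. u \<subseteq> Field r \<and> cf_sup_ne_cf_card r u}"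

definition filter_on :: "'b set \<Rightarrow> 'b set set \<Rightarrow> bool" where
  "filter_on U D \<longleftrightarrow> (\<forall>X\<in>D. X \<subseteq> U) \<and> U \<in> D \<and> {} \<notin> D \<and>
     (\<forall>X\<in>D. \<forall>Y. X \<subseteq> Y \<and> Y \<subseteq> U \<longrightarrow> Y \<in> D) \<and>
     (\<forall>X\<in>D. \<forall>Y\<in>D. X \<inter> Y \<in> D)"

definition fine_filter :: "'a rel \<Rightarrow> 'a set set \<Rightarrow> 'a set set set \<Rightarrow> bool" where
  "fine_filter r U D \<longleftrightarrow> (\<forall>\<alpha>\<in>Field r. {u\<in>U. \<alpha> \<in> u} \<in> D)"

definition normal_filter :: "'a rel \<Rightarrow> 'a set set \<Rightarrow> 'a set set set \<Rightarrow> bool" where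
  "normal_filter r U D \<longleftrightarrow> (\<forall>X :: 'a \<Rightarrow> 'a set set. (\<forall>\<alpha>\<in>Field r. X \<alpha> \<in> D) \<longrightarrow>
     {u\<in>U. \<forall>\<alpha>\<in>u. u \<in> X \<alpha>} \<in> D)"

end

theory Submission
  imports Defs
begin

text \<open>Fix functions \<open>F i\<close> from lambda to lambda, one for each \<open>i\<close> below the successor of lambda,
pairwise eventually different. For a typical \<open>u\<close>, closed under the relevant \<open>F i\<close>, well-order
\<open>u\<close> in its cardinality. Since cf(sup u) and cf(|u|) differ, some proper initial segment of this
well-order contains both \<open>x\<close> and \<open>F i x\<close> for cofinally many \<open>x\<close> in \<open>u\<close>; let \<open>c i\<close> be an upper
bound of it in \<open>u\<close>. Split \<open>u\<close> into disjoint pieces \<open>B c\<close> of size \<open>|u|\<close>, and choose the value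
\<open>f j u\<close> in \<open>B (c j)\<close> by recursion on \<open>j\<close>, avoiding \<open>f i u\<close> for those \<open>i < j\<close> that a fixed
injection of \<open>j\<close> into lambda maps into \<open>u\<close>. Only the \<open>i\<close> with \<open>c i = c j\<close> matter, and there are fewer
than \<open>|u|\<close> of them: if \<open>x\<close> is large and both \<open>x\<close> and \<open>F i x\<close> are in the segment up to \<open>c j\<close>,
then the pair \<open>(x, F i x)\<close> determines \<open>i\<close>.\<close>

unbundle cardinal_syntax

section \<open>Well-orders and cofinality\<close>

lemma Well_order_linear:
  assumes "Well_order r"
  shows "x \<in> Field r \<Longrightarrow> y \<in> Field r \<Longrightarrow> (x, y) \<in> r \<or> (y, x) \<in> r"
    and "(x, y) \<in> r \<Longrightarrow> (y, z) \<in> r \<Longrightarrow> (x, z) \<in> r"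
    and "(x, y) \<in> r \<Longrightarrow> (y, x) \<in> r \<Longrightarrow> x = y"
  using wo_rel.TOTALS[of r] wo_rel.TRANS[of r] wo_rel.ANTISYM[of r] assms
  by (auto simp: wo_rel_def dest: transD antisymD)

lemmas card_of_linear = Well_order_linear[OF card_of_Well_order, unfolded Field_card_of]

text \<open>The condition \<open>cf_sup_ne_cf_card\<close> is universal over pairs of witnesses, so
  it can be contradicted only once witnesses are produced. Cardinals are well-ordered, hence some
  cofinal set has least cardinality.\<close>

lemma cf_witness_exists:
  assumes "cofinal_subset r S S'"
  shows "\<exists>C. cf_witness r S C"
proof -
  have "\<exists>m\<in>card_of ` {C. cofinal_subset r S C}. \<forall>m'\<in>card_of ` {C. cofinal_subset r S C}. m \<le>o m'"
    by (rule exists_minim_Card_order) (use assms in \<open>auto simp: card_of_Card_order\<close>)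
  then show ?thesis by (auto simp: cf_witness_def)
qed

text \<open>This is where the inequality of the cofinalities enters. If for every \<open>c\<close>
  the points \<open>x\<close> with \<open>p x\<close> \<le> \<open>c\<close> were bounded in
  \<open>u\<close>, say by \<open>b c\<close>, then \<open>b\<close> would carry a cofinal subset of
  \<open>|u|\<close> to one of sup u, and \<open>p\<close> would carry a cofinal subset of sup u,
  once lifted into \<open>u\<close>, to one of \<open>|u|\<close>. The two cofinalities would then
  coincide.\<close>

lemma cofinal_fibre:
  assumes r: "Well_order r" and u: "u \<subseteq> Field r" and cf: "cf_sup_ne_cf_card r u"
    and nomax: "\<forall>x\<in>u. \<exists>y\<in>u. (x, y) \<in> r \<and> x \<noteq> y" and p: "p ` u \<subseteq> u"
  shows "\<exists>c\<in>u. \<forall>b\<in>u. \<exists>x\<in>u. (b, x) \<in> r \<and> (p x, c) \<in> |u|"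
proof (rule ccontr)
  assume "\<not> ?thesis"
  then have "\<forall>c\<in>u. \<exists>b\<in>u. \<forall>x\<in>u. (p x, c) \<in> |u| \<longrightarrow> (b, x) \<notin> r" by blast
  then obtain b where bu: "\<And>c. c \<in> u \<Longrightarrow> b c \<in> u"
    and b: "\<And>c x. c \<in> u \<Longrightarrow> x \<in> u \<Longrightarrow> (p x, c) \<in> |u| \<Longrightarrow> (b c, x) \<notin> r" by metis
  let ?d = "ord_sup_set r u"
  note tot = Well_order_linear(1)[OF r] and tr = Well_order_linear(2)[OF r]
  note totu = card_of_linear(1)
  have reflu: "(x, x) \<in> |u|" if "x \<in> u" for x using totu[OF that that] by simp
  have ud: "u \<subseteq> ?d" using u nomax by (auto simp: ord_sup_set_def)
  have du: "\<exists>y\<in>u. (x, y) \<in> r" if "x \<in> ?d" for x using that by (auto simp: ord_sup_set_def)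
  have "\<exists>C. cf_witness r ?d C"
    by (rule cf_witness_exists[where S' = u]) (use ud du in \<open>auto simp: cofinal_subset_def\<close>)
  then obtain C1 where C1: "cf_witness r ?d C1" ..
  have "\<exists>C. cf_witness (card_of u) u C"
    by (rule cf_witness_exists[where S' = u]) (use reflu in \<open>auto simp: cofinal_subset_def\<close>)
  then obtain C2 where C2: "cf_witness (card_of u) u C2" ..
  have sub1: "C1 \<subseteq> ?d" and cof1: "\<And>x. x \<in> ?d \<Longrightarrow> \<exists>c\<in>C1. (x, c) \<in> r"
    and sub2: "C2 \<subseteq> u" and cof2: "\<And>x. x \<in> u \<Longrightarrow> \<exists>c\<in>C2. (x, c) \<in> |u|"
    using C1 C2 by (auto simp: cf_witness_def cofinal_subset_def)
  have "cofinal_subset r ?d (b ` C2)"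
    unfolding cofinal_subset_def
  proof (intro conjI ballI)
    show "b ` C2 \<subseteq> ?d" using sub2 bu ud by blast
    fix x assume "x \<in> ?d"
    then obtain y where y: "y \<in> u" "(x, y) \<in> r" using du by blast
    then obtain c where c: "c \<in> C2" "(p y, c) \<in> |u|" using cof2[of "p y"] p by blast
    then have "(b c, y) \<notin> r" using b[of c y] y sub2 by blast
    then have "(y, b c) \<in> r" using tot[of y "b c"] y bu[of c] c sub2 u by blast
    then show "\<exists>z\<in>b ` C2. (x, z) \<in> r" using tr y c by blast
  qed
  then have "|C1| \<le>o |b ` C2|" using C1 by (auto simp: cf_witness_def)
  then have le1: "|C1| \<le>o |C2|" using card_of_image ordLeq_transitive by blast
  \<comment> \<open>Points of \<open>C1\<close> need not lie in \<open>u\<close>, where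
    \<open>p\<close> acts; \<open>t\<close> lifts them into \<open>u\<close>.\<close>
  have "\<forall>x\<in>C1. \<exists>y\<in>u. (x, y) \<in> r" using sub1 du by blast
  then obtain t where t: "\<And>x. x \<in> C1 \<Longrightarrow> t x \<in> u \<and> (x, t x) \<in> r" by metis
  have "cofinal_subset (card_of u) u ((\<lambda>x. p (t x)) ` C1)"
    unfolding cofinal_subset_def
  proof (intro conjI ballI)
    show "(\<lambda>x. p (t x)) ` C1 \<subseteq> u" using t p by blast
    fix c assume c: "c \<in> u"
    then obtain x where x: "x \<in> C1" "(b c, x) \<in> r" using cof1[of "b c"] bu ud by blast
    then have "(b c, t x) \<in> r" using t tr by blast
    then have "(p (t x), c) \<notin> |u|" using b[of c "t x"] c t x by blast
    then have "(c, p (t x)) \<in> |u|" using totu[of c u "p (t x)"] c t x p by blast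
    then show "\<exists>z\<in>(\<lambda>x. p (t x)) ` C1. (c, z) \<in> |u|" using x by blast
  qed
  then have "|C2| \<le>o |(\<lambda>x. p (t x)) ` C1|" using C2 by (auto simp: cf_witness_def)
  then have "|C2| \<le>o |C1|" using card_of_image ordLeq_transitive by blast
  then have "|C1| =o |C2|" using le1 ordIso_iff_ordLeq by blast
  then show False using cf C1 C2 by (auto simp: cf_sup_ne_cf_card_def)
qed

section \<open>Cardinal arithmetic of initial segments and partitions\<close>

lemma card_of_Times_self_ordLess_infinite:
  assumes "infinite A" "|V| <o |A|"
  shows "|V \<times> V| <o |A|"
proof (cases "finite V")
  case True
  then show ?thesis using assms(1)
    by (intro finite_ordLess_infinite card_of_Well_order) (auto simp: Field_card_of)
next
  case False
  then show ?thesis using card_of_Times_same_infinite assms(2) ordIso_ordLess_trans by blast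
qed

text \<open>An infinite cardinal is a limit ordinal, so the closed segment up to \<open>c\<close>
  sits inside the strict segment below some larger \<open>b\<close>.\<close>

lemma card_of_under_ordLess:
  assumes "infinite A" "c \<in> A"
  shows "|under (card_of A) c| <o |A|"
proof -
  have co: "Card_order |A|" by (rule card_of_Card_order)
  have inf: "infinite (Field |A| )" and cF: "c \<in> Field |A|" using assms by (simp_all add: Field_card_of)
  obtain b where b: "b \<in> Field |A|" "c \<noteq> b" "(c, b) \<in> |A|"
    using infinite_Card_order_limit[OF co inf cF] by blast
  have "under (card_of A) c \<subseteq> underS (card_of A) b"
    using b by (auto simp: under_def underS_def dest: card_of_linear(2,3))
  then show ?thesis using card_of_underS[OF co b(1)] card_of_mono1 ordLeq_ordLess_trans by blast
qed

text \<open>Each \<open>i\<close> in \<open>T\<close> selects a point \<open>x i\<close> strictly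
  above \<open>g i\<close> such that \<open>x i\<close> and \<open>F i (x i)\<close> both lie in the
  segment up to \<open>c\<close>. Two indices with the same pair would agree at a point above both
  of their thresholds, against \<open>diff\<close>. So \<open>T\<close> embeds into the square of a
  segment smaller than \<open>|u|\<close>, and this square is again smaller than
  \<open>|u|\<close>.\<close>

lemma card_of_common_segment_ordLess:
  assumes r: "Well_order r" and u: "u \<subseteq> Field r" and inf: "infinite u"
    and nomax: "\<forall>x\<in>u. \<exists>y\<in>u. (x, y) \<in> r \<and> x \<noteq> y" and c: "c \<in> u"
    and g: "\<And>i. i \<in> T \<Longrightarrow> g i \<in> u"
    and cof: "\<And>i b. i \<in> T \<Longrightarrow> b \<in> u \<Longrightarrow> \<exists>x\<in>u. (b, x) \<in> r \<and> (x, c) \<in> |u| \<and> (F i x, c) \<in> |u|"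
    and diff: "\<And>i i' x. i \<in> T \<Longrightarrow> i' \<in> T \<Longrightarrow> i \<noteq> i' \<Longrightarrow> x \<in> u \<Longrightarrow> F i x = F i' x \<Longrightarrow>
                 (x, g i) \<in> r \<or> (x, g i') \<in> r"
  shows "|T| <o |u|"
proof -
  note tr = Well_order_linear(2)[OF r] and as = Well_order_linear(3)[OF r]
  have "\<exists>x\<in>u. (x, g i) \<notin> r \<and> (x, c) \<in> |u| \<and> (F i x, c) \<in> |u|" if i: "i \<in> T" for i
  proof -
    obtain y where y: "y \<in> u" "(g i, y) \<in> r" "g i \<noteq> y" using nomax g[OF i] by blast
    obtain x where x: "x \<in> u" "(y, x) \<in> r" "(x, c) \<in> |u|" "(F i x, c) \<in> |u|"
      using cof[OF i y(1)] by blast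
    have "(x, g i) \<notin> r" using tr as y x by metis
    then show ?thesis using x by blast
  qed
  then obtain x where x: "\<And>i. i \<in> T \<Longrightarrow> x i \<in> u \<and> (x i, g i) \<notin> r \<and> (x i, c) \<in> |u| \<and> (F i (x i), c) \<in> |u|"
    by metis
  let ?V = "under (card_of u) c"
  have "inj_on (\<lambda>i. (x i, F i (x i))) T"
  proof (rule inj_onI)
    fix i i' assume i: "i \<in> T" "i' \<in> T" and eq: "(x i, F i (x i)) = (x i', F i' (x i'))"
    then have "x i = x i'" "F i (x i) = F i' (x i)" by auto
    then show "i = i'" using diff[OF i, of "x i"] x[OF i(1)] x[OF i(2)] by metis
  qed
  moreover have "(\<lambda>i. (x i, F i (x i))) ` T \<subseteq> ?V \<times> ?V" using x by (auto simp: under_def)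
  ultimately have "|T| \<le>o |?V \<times> ?V|" using card_of_ordLeq by blast
  then show ?thesis
    using card_of_Times_self_ordLess_infinite[OF inf card_of_under_ordLess[OF inf c]]
      ordLeq_ordLess_trans by blast
qed

text \<open>The columns of the square of \<open>u\<close> are carried over along a bijection of the
  square with \<open>u\<close>.\<close>

lemma infinite_partition:
  assumes "infinite u"
  shows "\<exists>B. (\<forall>c\<in>u. B c \<subseteq> u \<and> |u| \<le>o |B c| ) \<and> (\<forall>c\<in>u. \<forall>c'\<in>u. c \<noteq> c' \<longrightarrow> B c \<inter> B c' = {})"
proof -
  obtain k where k: "bij_betw k (u \<times> u) u"
    using card_of_Times_same_infinite[OF assms] card_of_ordIso by blast
  have inj: "inj_on k (u \<times> u)" and im: "k ` (u \<times> u) = u" using k by (auto simp: bij_betw_def)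
  have "|u| \<le>o |k ` ({c} \<times> u)|" if "c \<in> u" for c
    using that inj by (intro card_of_ordLeqI[of "\<lambda>y. k (c, y)"]) (auto simp: inj_on_def)
  moreover have "k ` ({c} \<times> u) \<subseteq> u" if "c \<in> u" for c using that im by blast
  moreover have "k ` ({c} \<times> u) \<inter> k ` ({c'} \<times> u) = {}" if "c \<in> u" "c' \<in> u" "c \<noteq> c'" for c c'
    using that inj by (auto simp: inj_on_def)
  ultimately show ?thesis by (intro exI[of _ "\<lambda>c. k ` ({c} \<times> u)"]) simp
qed

section \<open>Distinct values at a single set\<close>

lemma avoiding_choice:
  assumes wf: "wf R" and ne: "\<And>j. B j \<noteq> {}" and S: "\<And>i j. i \<in> S j \<Longrightarrow> (i, j) \<in> R"
  shows "\<exists>f. \<forall>j. f j \<in> B j \<and> (\<not> B j \<subseteq> f ` S j \<longrightarrow> f j \<notin> f ` S j)"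
proof (rule dependent_wf_choice[OF wf, where P = "\<lambda>f j v. v \<in> B j \<and> (\<not> B j \<subseteq> f ` S j \<longrightarrow> v \<notin> f ` S j)"])
  fix f g :: "'a \<Rightarrow> 'b" and x v assume "\<And>z. (z, x) \<in> R \<Longrightarrow> f z = g z"
  then have "f ` S x = g ` S x" using S by (intro image_cong) auto
  then show "(v \<in> B x \<and> (\<not> B x \<subseteq> f ` S x \<longrightarrow> v \<notin> f ` S x)) = (v \<in> B x \<and> (\<not> B x \<subseteq> g ` S x \<longrightarrow> v \<notin> g ` S x))"
    by simp
next
  fix x and f :: "'a \<Rightarrow> 'b"
  \<comment> \<open>If the earlier values exhaust \<open>B x\<close>, any element of
    \<open>B x\<close> serves as a default. This keeps the recursion total, and exhaustion can be
    excluded afterwards for the indices that matter.\<close>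
  show "\<exists>v. v \<in> B x \<and> (\<not> B x \<subseteq> f ` S x \<longrightarrow> v \<notin> f ` S x)" using ne[of x] by blast
qed

text \<open>The conditions on \<open>j\<close> stand inside the conclusion because one
  \<open>f\<close> has to serve all \<open>j\<close> at once, while for a given \<open>u\<close>
  they may hold for some \<open>j\<close> only.\<close>

lemma distinct_values_at:
  assumes r: "Well_order r" and u: "u \<subseteq> Field r" "u \<noteq> {}" and cf: "cf_sup_ne_cf_card r u"
    and wf: "wf R" and S: "\<And>i j. i \<in> S j \<Longrightarrow> (i, j) \<in> R"
  shows "\<exists>f. (\<forall>j. f j \<in> u) \<and>
    (\<forall>j. (\<forall>x\<in>u. \<exists>y\<in>u. (x, y) \<in> r \<and> x \<noteq> y) \<and> (\<forall>i\<in>S j. F i ` u \<subseteq> u \<and> g j i \<in> u) \<and>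
      (\<forall>i\<in>S j. \<forall>i'\<in>S j. i \<noteq> i' \<longrightarrow> (\<forall>x\<in>u. F i x = F i' x \<longrightarrow> (x, g j i) \<in> r \<or> (x, g j i') \<in> r))
      \<longrightarrow> f j \<notin> f ` S j)"
proof (cases "\<forall>x\<in>u. \<exists>y\<in>u. (x, y) \<in> r \<and> x \<noteq> y")
  case False
  obtain a where "a \<in> u" using u(2) by blast
  then show ?thesis using False by (intro exI[of _ "\<lambda>_. a"]) blast
next
  case nomax: True
  have inf: "infinite u"
  proof
    assume fin: "finite u"
    let ?R = "\<lambda>x y. (x, y) \<in> r \<and> x \<noteq> y"
    have "asymp_on u ?R"
    proof (rule asymp_onI)
      fix x y assume "?R x y"
      then show "\<not> ?R y x" using Well_order_linear(3)[OF r, of x y] by blast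
    qed
    moreover have "transp_on u ?R"
    proof (rule transp_onI)
      fix x y z assume "?R x y" "?R y z"
      then show "?R x z" using Well_order_linear(2,3)[OF r, of x y] by blast
    qed
    ultimately have "\<exists>m\<in>u. \<forall>y\<in>u. y \<noteq> m \<longrightarrow> \<not> ?R m y"
      using Finite_Set.bex_max_element[OF fin, of ?R] u(2) by simp
    then show False using nomax by metis
  qed
  obtain B where B: "\<And>c. c \<in> u \<Longrightarrow> B c \<subseteq> u" "\<And>c. c \<in> u \<Longrightarrow> |u| \<le>o |B c|"
    and disj: "\<And>c c'. c \<in> u \<Longrightarrow> c' \<in> u \<Longrightarrow> c \<noteq> c' \<Longrightarrow> B c \<inter> B c' = {}"
    using infinite_partition[OF inf] by metis
  have Bne: "B c \<noteq> {}" if "c \<in> u" for c using B(2)[OF that] inf card_of_ordLeq_finite by fastforce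
  define Q where "Q i c \<longleftrightarrow> (\<forall>b\<in>u. \<exists>x\<in>u. (b, x) \<in> r \<and> (x, c) \<in> |u| \<and> (F i x, c) \<in> |u| )" for i c
  have "\<forall>i. \<exists>c\<in>u. F i ` u \<subseteq> u \<longrightarrow> Q i c"
  proof
    fix i
    show "\<exists>c\<in>u. F i ` u \<subseteq> u \<longrightarrow> Q i c"
    proof (cases "F i ` u \<subseteq> u")
      case True
      \<comment> \<open>This is the larger of \<open>x\<close> and \<open>F i x\<close> in the order
        \<open>|u|\<close>, so a bound on it bounds both.\<close>
      let ?p = "\<lambda>x. if (x, F i x) \<in> |u| then F i x else x"
      have "?p ` u \<subseteq> u" using True by auto
      from cofinal_fibre[OF r u(1) cf nomax this] obtain c where c: "c \<in> u"
        and cc: "\<And>b. b \<in> u \<Longrightarrow> \<exists>x\<in>u. (b, x) \<in> r \<and> (?p x, c) \<in> |u|" by blast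
      have "(x, c) \<in> |u| \<and> (F i x, c) \<in> |u|" if "x \<in> u" "(?p x, c) \<in> |u|" for x
        using that card_of_linear(1)[of x u "F i x"] True by (auto split: if_splits dest: card_of_linear(2))
      then have "Q i c" unfolding Q_def using cc by blast
      then show ?thesis using c by blast
    qed (use u(2) in auto)
  qed
  \<comment> \<open>If \<open>F i\<close> leads out of \<open>u\<close>, then \<open>c i\<close> is
    just some element of \<open>u\<close>, which lets the recursion run over all indices.\<close>
  then obtain c where cu: "\<And>i. c i \<in> u" and cQ: "\<And>i. F i ` u \<subseteq> u \<Longrightarrow> Q i (c i)" by metis
  obtain f where fB: "\<And>j. f j \<in> B (c j)" and f: "\<And>j. \<not> B (c j) \<subseteq> f ` S j \<Longrightarrow> f j \<notin> f ` S j"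
    using avoiding_choice[OF wf, of "\<lambda>j. B (c j)" S] Bne cu S by blast
  have "f j \<notin> f ` S j"
    if good: "\<forall>i\<in>S j. F i ` u \<subseteq> u \<and> g j i \<in> u"
      "\<forall>i\<in>S j. \<forall>i'\<in>S j. i \<noteq> i' \<longrightarrow> (\<forall>x\<in>u. F i x = F i' x \<longrightarrow> (x, g j i) \<in> r \<or> (x, g j i') \<in> r)" for j
  proof (rule f, rule)
    assume sub: "B (c j) \<subseteq> f ` S j"
    let ?T = "{i \<in> S j. c i = c j}"
    have "B (c j) \<subseteq> f ` ?T"
    proof
      fix v assume v: "v \<in> B (c j)"
      then obtain i where i: "i \<in> S j" "v = f i" using sub by blast
      then have "c i = c j" using disj[OF cu[of i] cu[of j]] fB[of i] v by blast
      then show "v \<in> f ` ?T" using i by blast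
    qed
    then have "|u| \<le>o |?T|"
      using B(2)[OF cu[of j]] surj_imp_ordLeq ordLeq_transitive by blast
    moreover have "|?T| <o |u|"
    proof (rule card_of_common_segment_ordLess[OF r u(1) inf nomax cu[of j], where F = F and g = "g j"])
      fix i b assume "i \<in> ?T" "b \<in> u"
      then show "\<exists>x\<in>u. (b, x) \<in> r \<and> (x, c j) \<in> |u| \<and> (F i x, c j) \<in> |u|"
        using cQ[of i] good(1) unfolding Q_def by auto
    qed (use good in auto)
    ultimately show False using not_ordLess_ordLeq by blast
  qed
  moreover have "f j \<in> u" for j using fB B(1) cu by blast
  ultimately show ?thesis by blast
qed

section \<open>Eventually different functions and bounds for their agreement\<close>

lemma Well_order_wf_strict: "Well_order s \<Longrightarrow> wf (s - Id)"
  by (simp add: well_order_on_def)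

text \<open>Diagonalisation by recursion on \<open>j\<close>: with the predecessors of
  \<open>j\<close> injected into \<lambda> by \<open>e\<close>, the value at \<open>x\<close> avoids
  \<open>F i x\<close> for all \<open>i\<close> with \<open>e i\<close> below \<open>x\<close>,
  which are fewer than \<lambda> many. Agreement with \<open>F i\<close> is then possible only at
  \<open>x\<close> \<le> \<open>e i\<close>, so \<open>e i\<close> is the required bound.\<close>

lemma eventually_different_family:
  assumes r: "Card_order r" and s: "Well_order s"
    and small: "\<And>j. j \<in> Field s \<Longrightarrow> |underS s j| \<le>o r"
  shows "\<exists>F. (\<forall>i. \<forall>x\<in>Field r. F i x \<in> Field r) \<and>
    (\<forall>i\<in>Field s. \<forall>j\<in>Field s. i \<noteq> j \<longrightarrow> (\<exists>b\<in>Field r. \<forall>x\<in>Field r. F i x = F j x \<longrightarrow> (x, b) \<in> r))"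
proof -
  let ?P = "\<lambda>F j \<phi>. (\<forall>x\<in>Field r. \<phi> x \<in> Field r) \<and>
    (\<forall>i\<in>underS s j. \<exists>b\<in>Field r. \<forall>x\<in>Field r. F i x = \<phi> x \<longrightarrow> (x, b) \<in> r)"
  note tot = Well_order_linear(1)[OF card_order_on_well_order_on[OF r]]
  have "\<exists>F. \<forall>j. ?P F j (F j)"
  proof (rule dependent_wf_choice[OF Well_order_wf_strict[OF s]])
    fix F G :: "'b \<Rightarrow> 'a \<Rightarrow> 'a" and j \<phi> assume "\<And>i. (i, j) \<in> s - Id \<Longrightarrow> F i = G i"
    then have "\<And>i. i \<in> underS s j \<Longrightarrow> F i = G i" by (auto simp: underS_def)
    then show "?P F j \<phi> = ?P G j \<phi>" by simp
  next
    fix j and F :: "'b \<Rightarrow> 'a \<Rightarrow> 'a"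
    have "|underS s j| \<le>o |Field r|"
    proof (cases "j \<in> Field s")
      case True
      then show ?thesis using small card_of_Field_ordIso[OF r] ordIso_symmetric ordLeq_ordIso_trans by blast
    qed (simp add: underS_empty card_of_empty)
    then obtain e where e: "inj_on e (underS s j)" "e ` underS s j \<subseteq> Field r"
      unfolding card_of_ordLeq[symmetric] by blast
    have "\<exists>y\<in>Field r. \<forall>i\<in>underS s j. e i \<in> underS r x \<longrightarrow> F i x \<noteq> y" if x: "x \<in> Field r" for x
    proof (rule ccontr)
      let ?A = "{i \<in> underS s j. e i \<in> underS r x}"
      assume "\<not> ?thesis"
      then have "\<exists>i\<in>?A. y = F i x" if "y \<in> Field r" for y using that by auto
      then have "Field r \<subseteq> (\<lambda>i. F i x) ` ?A" by (auto simp: image_iff)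
      then have "|Field r| \<le>o |?A|" by (rule surj_imp_ordLeq)
      moreover have "|?A| \<le>o |underS r x|"
        by (rule card_of_ordLeqI[of e]) (use e in \<open>auto simp: inj_on_def\<close>)
      moreover have "|underS r x| <o |Field r|"
        using card_of_underS[OF r x] card_of_Field_ordIso[OF r] ordIso_symmetric ordLess_ordIso_trans by blast
      ultimately show False using ordLeq_transitive not_ordLess_ordLeq by blast
    qed
    then obtain \<phi> where \<phi>: "\<And>x. x \<in> Field r \<Longrightarrow> \<phi> x \<in> Field r"
      "\<And>x i. x \<in> Field r \<Longrightarrow> i \<in> underS s j \<Longrightarrow> e i \<in> underS r x \<Longrightarrow> F i x \<noteq> \<phi> x" by metis
    have "(x, e i) \<in> r" if "i \<in> underS s j" "x \<in> Field r" "F i x = \<phi> x" for i x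
      using \<phi>(2)[OF that(2,1)] that e(2) tot[of x "e i"] by (auto simp: underS_def)
    then have "?P F j \<phi>" using \<phi>(1) e(2) by blast
    then show "\<exists>\<phi>. ?P F j \<phi>" by (rule exI[where x = \<phi>])
  qed
  then obtain F where F: "\<And>j. ?P F j (F j)" by blast
  have "\<exists>b\<in>Field r. \<forall>x\<in>Field r. F i x = F j x \<longrightarrow> (x, b) \<in> r"
    if ij: "i \<in> Field s" "j \<in> Field s" "i \<noteq> j" for i j
  proof -
    have "i \<in> underS s j \<or> j \<in> underS s i"
      using Well_order_linear(1)[OF s ij(1,2)] ij(3) by (auto simp: underS_def)
    then show ?thesis using F[of i] F[of j] by metis
  qed
  then show ?thesis using F by (intro exI[of _ F]) blast
qed

lemma regularCard_bounded:
  assumes r: "Card_order r" and reg: "regularCard r" and K: "K \<subseteq> Field r" "|K| <o r"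
  shows "\<exists>a\<in>Field r. \<forall>b\<in>K. (b, a) \<in> r"
proof -
  have "\<not> cofinal K r" using reg K not_ordLess_ordIso unfolding regularCard_def by blast
  \<comment> \<open>The notion \<open>cofinal\<close> asks for a strictly larger element, so its
    failure leaves an upper bound \<open>a\<close> of \<open>K\<close>, possibly lying in
    \<open>K\<close>.\<close>
  then obtain a where a: "a \<in> Field r" "\<forall>b\<in>K. a = b \<or> (a, b) \<notin> r" unfolding cofinal_def by blast
  note tot = Well_order_linear(1)[OF card_order_on_well_order_on[OF r]]
  have "(b, a) \<in> r" if b: "b \<in> K" for b
  proof -
    have "b \<in> Field r" using b K(1) by blast
    then show ?thesis using a b tot[of a b] tot[of b b] by metis
  qed
  then show ?thesis using a by blast
qed

text \<open>Counting needs a threshold attached to a single index, whereas agreement is bounded pair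
  by pair. Let \<open>g i\<close> bound all \<open>b i i'\<close> for the \<open>i'\<close> that
  precede \<open>i\<close> under \<open>e\<close>; these are fewer than \<lambda> many, so
  regularity supplies \<open>g i\<close>. For any pair, the threshold of the index that comes later
  under \<open>e\<close> suffices.\<close>

lemma regularCard_bounding_function:
  assumes r: "Card_order r" and reg: "regularCard r"
    and e: "inj_on e I" "e ` I \<subseteq> Field r"
    and b: "\<And>i i'. i \<in> I \<Longrightarrow> i' \<in> I \<Longrightarrow> i \<noteq> i' \<Longrightarrow> \<exists>b\<in>Field r. \<forall>x. E i i' x \<longrightarrow> (x, b) \<in> r"
    and sym: "\<And>i i' x. E i i' x \<Longrightarrow> E i' i x"
  shows "\<exists>g. (\<forall>i\<in>I. g i \<in> Field r) \<and>
    (\<forall>i\<in>I. \<forall>i'\<in>I. i \<noteq> i' \<longrightarrow> (\<forall>x. E i i' x \<longrightarrow> (x, g i) \<in> r \<or> (x, g i') \<in> r))"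
proof -
  note tot = Well_order_linear(1)[OF card_order_on_well_order_on[OF r]]
  note tr = Well_order_linear(2)[OF card_order_on_well_order_on[OF r]]
  obtain b where bF: "\<And>i i'. i \<in> I \<Longrightarrow> i' \<in> I \<Longrightarrow> i \<noteq> i' \<Longrightarrow> b i i' \<in> Field r"
    and b: "\<And>i i' x. i \<in> I \<Longrightarrow> i' \<in> I \<Longrightarrow> i \<noteq> i' \<Longrightarrow> E i i' x \<Longrightarrow> (x, b i i') \<in> r"
    using b by metis
  have "\<exists>a\<in>Field r. \<forall>i'\<in>I. e i' \<in> underS r (e i) \<longrightarrow> (b i i', a) \<in> r" if i: "i \<in> I" for i
  proof -
    let ?A = "{i' \<in> I. e i' \<in> underS r (e i)}"
    have "|?A| \<le>o |underS r (e i)|"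
      by (rule card_of_ordLeqI[of e]) (use e in \<open>auto simp: inj_on_def\<close>)
    moreover have "|underS r (e i)| <o r" using card_of_underS[OF r] e(2) i by blast
    ultimately have "|?A| <o r" by (rule ordLeq_ordLess_trans)
    then have "|b i ` ?A| <o r" using card_of_image ordLeq_ordLess_trans by blast
    moreover have "b i ` ?A \<subseteq> Field r" using bF i by (auto simp: underS_def)
    ultimately show ?thesis using regularCard_bounded[OF r reg, of "b i ` ?A"] by auto
  qed
  then obtain g where gF: "\<And>i. i \<in> I \<Longrightarrow> g i \<in> Field r"
    and g: "\<And>i i'. i \<in> I \<Longrightarrow> i' \<in> I \<Longrightarrow> e i' \<in> underS r (e i) \<Longrightarrow> (b i i', g i) \<in> r" by metis
  have "(x, g i) \<in> r \<or> (x, g i') \<in> r" if i: "i \<in> I" "i' \<in> I" "i \<noteq> i'" and E: "E i i' x" for i i' x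
  proof -
    have "e i \<noteq> e i'" using e(1) i by (auto simp: inj_on_def)
    then have "e i' \<in> underS r (e i) \<or> e i \<in> underS r (e i')"
      using tot[of "e i" "e i'"] e(2) i by (auto simp: underS_def)
    then show ?thesis using g[of i i'] g[of i' i] b[of i i' x] b[of i' i x] i E sym[OF E] tr by metis
  qed
  then show ?thesis using gF by blast
qed

section \<open>Fine normal filters\<close>

lemma normal_filter_diagonal:
  assumes "normal_filter r U D" and "\<And>\<alpha>. \<alpha> \<in> Field r \<Longrightarrow> {u\<in>U. P \<alpha> u} \<in> D"
  shows "{u\<in>U. \<forall>\<alpha>\<in>u. P \<alpha> u} \<in> D"
proof -
  have "{u\<in>U. \<forall>\<alpha>\<in>u. u \<in> {u\<in>U. P \<alpha> u}} \<in> D"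
    using assms(1)[unfolded normal_filter_def, THEN spec, of "\<lambda>\<alpha>. {u\<in>U. P \<alpha> u}"] assms(2) by simp
  moreover have "{u\<in>U. \<forall>\<alpha>\<in>u. u \<in> {u\<in>U. P \<alpha> u}} = {u\<in>U. \<forall>\<alpha>\<in>u. P \<alpha> u}" by blast
  ultimately show ?thesis by simp
qed

lemma filter_on_Int:
  assumes "filter_on U D" "{u\<in>U. P u} \<in> D" "{u\<in>U. Q u} \<in> D"
  shows "{u\<in>U. P u \<and> Q u} \<in> D"
proof -
  have "{u\<in>U. P u} \<inter> {u\<in>U. Q u} \<in> D" using assms unfolding filter_on_def by blast
  moreover have "{u\<in>U. P u} \<inter> {u\<in>U. Q u} = {u\<in>U. P u \<and> Q u}" by blast
  ultimately show ?thesis by simp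
qed

lemma filter_on_mono:
  assumes "filter_on U D" "{u\<in>U. P u} \<in> D" "\<And>u. u \<in> U \<Longrightarrow> P u \<Longrightarrow> Q u"
  shows "{u\<in>U. Q u} \<in> D"
proof -
  have "{u\<in>U. P u} \<subseteq> {u\<in>U. Q u}" using assms(3) by blast
  moreover have "{u\<in>U. Q u} \<subseteq> U" by blast
  ultimately show ?thesis using assms(1,2) unfolding filter_on_def by meson
qed

text \<open>For each single \<alpha>, fineness puts \<open>h \<alpha>\<close> into almost every
  \<open>u\<close>; normality achieves this for all \<alpha> in \<open>u\<close>
  simultaneously.\<close>

lemma almost_all_closed:
  assumes "fine_filter r U D" "normal_filter r U D" "\<And>\<alpha>. \<alpha> \<in> Field r \<Longrightarrow> h \<alpha> \<in> Field r"
  shows "{u\<in>U. \<forall>\<alpha>\<in>u. h \<alpha> \<in> u} \<in> D"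
  by (rule normal_filter_diagonal[OF assms(2)]) (use assms in \<open>auto simp: fine_filter_def\<close>)

text \<open>Normality is transferred to the index set \<open>I\<close> by coding. An ordinal
  \<alpha> codes at most one \<open>i\<close>, and at an \<alpha> that codes none the whole of
  \<open>U\<close> enters the diagonal intersection.\<close>

lemma almost_all_indexed:
  assumes filter: "filter_on U D" and normal: "normal_filter r U D" and inj: "inj_on e I"
    and P: "\<And>i. i \<in> I \<Longrightarrow> {u\<in>U. P i u} \<in> D"
  shows "{u\<in>U. \<forall>i\<in>I. e i \<in> u \<longrightarrow> P i u} \<in> D"
proof -
  have "{u\<in>U. \<forall>\<alpha>\<in>u. \<forall>i\<in>I. e i = \<alpha> \<longrightarrow> P i u} \<in> D"
  proof (rule normal_filter_diagonal[OF normal])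
    fix \<alpha>
    show "{u\<in>U. \<forall>i\<in>I. e i = \<alpha> \<longrightarrow> P i u} \<in> D"
    proof (cases "\<alpha> \<in> e ` I")
      case True
      then obtain i where i: "i \<in> I" "e i = \<alpha>" by blast
      then show ?thesis
        by (intro filter_on_mono[OF filter P[OF i(1)]]) (use inj in \<open>auto simp: inj_on_def\<close>)
    next
      case False
      then have "{u\<in>U. \<forall>i\<in>I. e i = \<alpha> \<longrightarrow> P i u} = U" by auto
      then show ?thesis using filter by (simp add: filter_on_def)
    qed
  qed
  then show ?thesis by (rule filter_on_mono[OF filter]) auto
qed

text \<open>For the empty set both cofinalities are 0. Hence all members of \<open>U_set r\<close>
  are nonempty, and values in \<open>u\<close> can be chosen at every \<open>u\<close>.\<close>

lemma empty_notin_U_set: "{} \<notin> U_set (r :: 'a rel)"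
proof -
  have w: "cf_witness q {} {}" for q :: "'a rel"
    by (simp add: cf_witness_def cofinal_subset_def card_of_empty)
  have "ord_sup_set r {} = {}" by (simp add: ord_sup_set_def)
  moreover have "|{} :: 'a set| =o |{} :: 'a set|" by (rule card_of_refl)
  ultimately have "\<not> cf_sup_ne_cf_card r {}"
    unfolding cf_sup_ne_cf_card_def using w[of r] w[of "|{}|"] by metis
  then show ?thesis by (simp add: U_set_def)
qed

section \<open>Assembling the functions\<close>

theorem theorem4p1:
  fixes r :: "'a rel" and D :: "'a set set set"
  assumes "Card_order r" and "Cinfinite r" and "regularCard r"
    and "filter_on (U_set r) D"
    and "fine_filter r (U_set r) D"
    and "normal_filter r (U_set r) D"
  shows "\<exists>f :: 'a set \<Rightarrow> 'a set \<Rightarrow> 'a.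
           (\<forall>i\<in>Field (cardSuc r). \<forall>u\<in>U_set r. f i u \<in> u) \<and>
           (\<forall>i\<in>Field (cardSuc r). \<forall>j\<in>Field (cardSuc r). i \<noteq> j \<longrightarrow>
              {u\<in>U_set r. f i u \<noteq> f j u} \<in> D)"
proof -
  note r = assms(1) and filter = assms(4) and fine = assms(5) and normal = assms(6)
  let ?s = "cardSuc r" and ?U = "U_set r"
  have wr: "Well_order r" using r by (simp add: card_order_on_def)
  have ws: "Well_order ?s" by (rule cardSuc_Well_order[OF r])
  have small: "|underS ?s j| \<le>o r" if "j \<in> Field ?s" for j
    using card_of_underS[OF cardSuc_Card_order[OF r] that]
      cardSuc_ordLeq_ordLess[OF r card_of_Card_order] by blast
  obtain F where F: "\<And>i x. x \<in> Field r \<Longrightarrow> F i x \<in> Field r"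
    and diff: "\<And>i j. i \<in> Field ?s \<Longrightarrow> j \<in> Field ?s \<Longrightarrow> i \<noteq> j \<Longrightarrow>
                 \<exists>b\<in>Field r. \<forall>x\<in>Field r. F i x = F j x \<longrightarrow> (x, b) \<in> r"
    using eventually_different_family[OF r ws small] by metis
  have "\<exists>e. inj_on e (underS ?s j) \<and> e ` underS ?s j \<subseteq> Field r" if "j \<in> Field ?s" for j
    using small[OF that] card_of_Field_ordIso[OF r] ordIso_symmetric ordLeq_ordIso_trans
      card_of_ordLeq[of "underS ?s j" "Field r"] by blast
  then obtain e where e: "\<And>j. j \<in> Field ?s \<Longrightarrow> inj_on (e j) (underS ?s j)"
    "\<And>j. j \<in> Field ?s \<Longrightarrow> e j ` underS ?s j \<subseteq> Field r" by metis
  \<comment> \<open>Thresholds are found separately for each \<open>j\<close>: its predecessors,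
    unlike all of the successor cardinal, embed into \<lambda>.\<close>
  have "\<exists>g. (\<forall>i\<in>underS ?s j. g i \<in> Field r) \<and>
      (\<forall>i\<in>underS ?s j. \<forall>i'\<in>underS ?s j. i \<noteq> i' \<longrightarrow>
        (\<forall>x. (x \<in> Field r \<and> F i x = F i' x) \<longrightarrow> (x, g i) \<in> r \<or> (x, g i') \<in> r))"
    if j: "j \<in> Field ?s" for j
  proof (rule regularCard_bounding_function[OF r assms(3) e[OF j]])
    fix i i' assume "i \<in> underS ?s j" "i' \<in> underS ?s j" "i \<noteq> i'"
    moreover have "underS ?s j \<subseteq> Field ?s" by (rule Order_Relation.underS_Field)
    ultimately show "\<exists>b\<in>Field r. \<forall>x. x \<in> Field r \<and> F i x = F i' x \<longrightarrow> (x, b) \<in> r"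
      using diff[of i i'] by blast
  qed auto
  then obtain g where g: "\<And>j i. j \<in> Field ?s \<Longrightarrow> i \<in> underS ?s j \<Longrightarrow> g j i \<in> Field r"
    and gdiff: "\<And>j i i' x. j \<in> Field ?s \<Longrightarrow> i \<in> underS ?s j \<Longrightarrow> i' \<in> underS ?s j \<Longrightarrow> i \<noteq> i' \<Longrightarrow>
                 x \<in> Field r \<Longrightarrow> F i x = F i' x \<Longrightarrow> (x, g j i) \<in> r \<or> (x, g j i') \<in> r" by metis
  define S where "S u j = {i \<in> underS ?s j. e j i \<in> u}" for u j
  define nomax where "nomax u \<longleftrightarrow> (\<forall>x\<in>u. \<exists>y\<in>u. (x, y) \<in> r \<and> x \<noteq> y)" for u
  \<comment> \<open>Only predecessors with code in \<open>u\<close> are considered, so that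
    normality can gather up to \<lambda> many conditions along \<open>e j\<close>.\<close>
  define closed where "closed j u \<longleftrightarrow> (\<forall>i\<in>S u j. F i ` u \<subseteq> u \<and> g j i \<in> u)" for j u
  \<comment> \<open>The choice is made at every \<open>u\<close>, also where \<open>nomax\<close> or
    \<open>closed\<close> fails; there only membership in \<open>u\<close> is claimed.\<close>
  have "\<exists>f. (\<forall>j. f j \<in> u) \<and> (\<forall>j\<in>Field ?s. nomax u \<and> closed j u \<longrightarrow> f j \<notin> f ` S u j)"
    if u: "u \<in> ?U" for u
  proof -
    have uF: "u \<subseteq> Field r" and cf: "cf_sup_ne_cf_card r u" using u by (auto simp: U_set_def)
    have ne: "u \<noteq> {}" using u empty_notin_U_set by blast
    have "\<And>i j. i \<in> S u j \<Longrightarrow> (i, j) \<in> ?s - Id" by (auto simp: S_def underS_def)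
    from distinct_values_at[where g = g and F = F, OF wr uF ne cf Well_order_wf_strict[OF ws] this]
    obtain f where f: "\<And>j. f j \<in> u"
      and fS: "\<And>j. nomax u \<Longrightarrow> closed j u \<Longrightarrow>
        \<forall>i\<in>S u j. \<forall>i'\<in>S u j. i \<noteq> i' \<longrightarrow> (\<forall>x\<in>u. F i x = F i' x \<longrightarrow> (x, g j i) \<in> r \<or> (x, g j i') \<in> r) \<Longrightarrow>
        f j \<notin> f ` S u j"
      unfolding nomax_def closed_def by (metis (mono_tags))
    have "f j \<notin> f ` S u j" if j: "j \<in> Field ?s" and *: "nomax u" "closed j u" for j
      by (rule fS[OF *]) (use gdiff[OF j] uF in \<open>auto simp: S_def\<close>)
    then show ?thesis using f by blast
  qed
  then obtain f where f: "\<And>u j. u \<in> ?U \<Longrightarrow> f u j \<in> u"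
    and fS: "\<And>u j. u \<in> ?U \<Longrightarrow> j \<in> Field ?s \<Longrightarrow> nomax u \<Longrightarrow> closed j u \<Longrightarrow> f u j \<notin> f u ` S u j"
    by metis
  have "\<forall>x\<in>Field r. \<exists>y\<in>Field r. (x, y) \<in> r \<and> x \<noteq> y"
    using infinite_Card_order_limit[OF r] assms(2) by (auto simp: cinfinite_def)
  \<comment> \<open>A set closed under this strictly increasing step has no maximum, so
    \<open>nomax\<close> holds almost everywhere.\<close>
  then obtain h where h: "\<And>x. x \<in> Field r \<Longrightarrow> h x \<in> Field r \<and> (x, h x) \<in> r \<and> x \<noteq> h x" by metis
  have "{u\<in>?U. \<forall>x\<in>u. h x \<in> u} \<in> D" by (rule almost_all_closed[OF fine normal]) (use h in blast)
  then have nomaxD: "{u\<in>?U. nomax u} \<in> D"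
  proof (rule filter_on_mono[OF filter])
    fix u assume "u \<in> ?U" "\<forall>x\<in>u. h x \<in> u"
    then show "nomax u" using h unfolding nomax_def U_set_def by blast
  qed
  have closedD: "{u\<in>?U. closed j u} \<in> D" if j: "j \<in> Field ?s" for j
  proof -
    have "{u\<in>?U. \<forall>i\<in>underS ?s j. e j i \<in> u \<longrightarrow> (\<forall>x\<in>u. F i x \<in> u) \<and> g j i \<in> u} \<in> D"
    proof (rule almost_all_indexed[OF filter normal e(1)[OF j]], rule filter_on_Int[OF filter])
      fix i assume i: "i \<in> underS ?s j"
      show "{u\<in>?U. \<forall>x\<in>u. F i x \<in> u} \<in> D" by (rule almost_all_closed[OF fine normal]) (rule F)
      show "{u\<in>?U. g j i \<in> u} \<in> D" using fine g[OF j i] by (simp add: fine_filter_def)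
    qed
    then show ?thesis by (rule filter_on_mono[OF filter]) (auto simp: closed_def S_def)
  qed
  have below: "{u\<in>?U. f u i \<noteq> f u j} \<in> D" if j: "j \<in> Field ?s" and i: "i \<in> underS ?s j" for i j
  proof -
    \<comment> \<open>Fineness puts the fixed \<open>i\<close> into \<open>S u j\<close> for almost
      all \<open>u\<close>, so the recursion at \<open>j\<close> did avoid \<open>f u i\<close>
      there.\<close>
    have "{u\<in>?U. e j i \<in> u} \<in> D" using fine e(2)[OF j] i by (auto simp: fine_filter_def)
    from filter_on_Int[OF filter filter_on_Int[OF filter nomaxD closedD[OF j]] this]
    show ?thesis
    proof (rule filter_on_mono[OF filter])
      fix u assume u: "u \<in> ?U" and "(nomax u \<and> closed j u) \<and> e j i \<in> u"
      then have "f u j \<notin> f u ` S u j" "i \<in> S u j" using fS[OF u j] i by (auto simp: S_def)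
      then show "f u i \<noteq> f u j" by (metis imageI)
    qed
  qed
  have "{u\<in>?U. f u i \<noteq> f u j} \<in> D" if ij: "i \<in> Field ?s" "j \<in> Field ?s" "i \<noteq> j" for i j
  proof -
    have "i \<in> underS ?s j \<or> j \<in> underS ?s i"
      using Well_order_linear(1)[OF ws ij(1,2)] ij(3) by (auto simp: underS_def)
    then show ?thesis using below[of j i] below[of i j] ij by (auto simp: eq_commute)
  qed
  then show ?thesis using f by (intro exI[of _ "\<lambda>i u. f u i"]) blast
qed

end
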